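(* Let $\varphi$ be a $C^2$ nonautonomous dynamical system on $X$ over the two-point set $J=\{t_0,t_0+T\}$ for some $t_0\in\mathbb{R}$ and $T>0$, and let $\alpha\in\mathbb{R}$. Then for every $x_0\in X(t_0)$ $$0\ \le\ \sum_{i=1}^n\big(\lambda_i(t_0,x_0,T)-\alpha\big)^+-h^{\alpha}_{t_0}(x_0)\ \le\ \frac{n\log2+\log\Gamma(\frac n2+1)-\frac n2\log\pi}{T},$$ where $a^+=\max\{a,0\}$, $\Gamma$ is the Gamma function, $\lambda_i(t_0,x_0,T)$, $i=1,\dots,n$, are the finite-time Lyapunov exponents of $\varphi$ at $(t_0,x_0)$, and $h^{\alpha}_{t_0}(x_0)$ is the finite-time metric entropy with weight $\alpha$ at $(t_0,x_0)$.
   Context: Let $J=\{t_0,t_0+T\}$, $T>0$, let $X(t)$, $t\in J$, be open subsets of $\mathbb{R}^n$ and $X:=\{(t,x)\in J\times\mathbb{R}^n: x\in X(t)\}$. A $C^2$ nonautonomous dynamical system (NDS) $\varphi$ on $X$ over $J$ is a family of $C^2$ maps $\varphi(t,s):X(s)\to X(t)$, $t,s\in J$, with $\varphi(s,s)x=x$ and $\varphi(t,u)\varphi(u,s)x=\varphi(t,s)x$ for all $t,u,s\in J$, $x\in X(s)$. (So $\varphi(t_0+T,t_0):X(t_0)\to X(t_0+T)$ is a $C^2$ diffeomorphism.) $\|\cdot\|$ is the Euclidean norm, $\mu$ is $n$-dimensional Lebesgue measure, $B(x_0,\varepsilon):=\{x\in\mathbb{R}^n:\|x-x_0\|\le\varepsilon\}$.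 For $\alpha\in\mathbb{R}$, $x_0\in X(t_0)$, $\varepsilon\ge0$ let $$B^{\alpha}_{t_0}(x_0,\varepsilon):=\Big\{x\in X(t_0):\sup_{t\in J}\|\varphi(t,t_0)x-\varphi(t,t_0)x_0\|e^{-\alpha(t-t_0)}\le\varepsilon\Big\}.$$ The finite-time metric entropy (FTME) with weight $\alpha$ at $(t_0,x_0)$ is (with $|J|=\max J-\min J=T$) $$h^{\alpha}_{t_0}(x_0):=\limsup_{\varepsilon\to0^+}-\frac1{|J|}\log\frac{\mu(B^{\alpha}_{t_0}(x_0,\varepsilon))}{\mu(B(x_0,\varepsilon))}.$$ The finite-time Lyapunov exponents of $\varphi$ at $(t_0,x_0)$ are $\lambda_i(t_0,x_0,T):=\frac1T\log\Lambda_i(t_0,x_0,T)$, where $\Lambda_1\ge\dots\ge\Lambda_n>0$ are the singular values of the derivative $D\varphi(t_0+T,t_0)(x_0)$ of $x\mapsto\varphi(t_0+T,t_0)x$ at $x_0$. *)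

theory Defs
  imports
    "HOL-Analysis.Analysis"
    "HOL-Computational_Algebra.Polynomial"
    "HOL-Library.Multiset"
begin

text \<open>
  Twice continuous differentiability on an open set \<open>S\<close>. The witnesses \<open>f'\<close> and \<open>f''\<close> are the
  first and second derivative on \<open>S\<close> and are irrelevant outside of \<open>S\<close>.
\<close>

definition C2_on :: "('a::real_normed_vector \<Rightarrow> 'b::real_normed_vector) \<Rightarrow> 'a set \<Rightarrow> bool" where
  "C2_on f S \<longleftrightarrow>
     (\<exists>(f' :: 'a \<Rightarrow> 'a \<Rightarrow>\<^sub>L 'b) (f'' :: 'a \<Rightarrow> 'a \<Rightarrow>\<^sub>L ('a \<Rightarrow>\<^sub>L 'b)).
        (\<forall>x\<in>S. (f has_derivative blinfun_apply (f' x)) (at x)) \<and>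
        (\<forall>x\<in>S. (f' has_derivative blinfun_apply (f'' x)) (at x)) \<and>
        continuous_on S f'')"

text \<open>
  \<open>X t\<close> and \<open>\<phi> t s\<close> are total functions, but only their values for \<open>t, s \<in> J\<close>, and those of
  \<open>\<phi> t s\<close> on \<open>X s\<close>, are constrained.
\<close>

locale C2_nds =
  fixes J :: "real set"
    and X :: "real \<Rightarrow> (real ^ 'n) set"
    and \<phi> :: "real \<Rightarrow> real \<Rightarrow> real ^ 'n \<Rightarrow> real ^ 'n"
  assumes open_fibre: "t \<in> J \<Longrightarrow> open (X t)"
    and maps_fibre: "\<lbrakk>t \<in> J; s \<in> J; x \<in> X s\<rbrakk> \<Longrightarrow> \<phi> t s x \<in> X t"
    and C2_fibre: "\<lbrakk>t \<in> J; s \<in> J\<rbrakk> \<Longrightarrow> C2_on (\<phi> t s) (X s)"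
    and identity: "\<lbrakk>s \<in> J; x \<in> X s\<rbrakk> \<Longrightarrow> \<phi> s s x = x"
    and cocycle: "\<lbrakk>t \<in> J; u \<in> J; s \<in> J; x \<in> X s\<rbrakk> \<Longrightarrow> \<phi> t u (\<phi> u s x) = \<phi> t s x"

text \<open>
  The time set \<open>J\<close> is meant to be finite and non-empty below, so that the supremum over \<open>J\<close> and
  \<open>Max J\<close>, \<open>Min J\<close> are meaningful.
\<close>

definition ft_ball ::
  "real set \<Rightarrow> (real \<Rightarrow> (real ^ 'n) set) \<Rightarrow> (real \<Rightarrow> real \<Rightarrow> real ^ 'n \<Rightarrow> real ^ 'n) \<Rightarrow>
   real \<Rightarrow> real \<Rightarrow> real ^ 'n \<Rightarrow> real \<Rightarrow> (real ^ 'n) set" where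
  "ft_ball J X \<phi> \<alpha> t0 x0 \<epsilon> =
     {x \<in> X t0. (SUP t\<in>J. norm (\<phi> t t0 x - \<phi> t t0 x0) * exp (- \<alpha> * (t - t0))) \<le> \<epsilon>}"

text \<open>
  The upper limit is taken in the extended reals. If \<open>C2_nds J X \<phi>\<close>, \<open>t0 \<in> J\<close>, \<open>x0 \<in> X t0\<close> and
  \<open>\<epsilon> > 0\<close>, the set \<open>ft_ball J X \<phi> \<alpha> t0 x0 \<epsilon>\<close> is contained in \<open>cball x0 \<epsilon>\<close> and is a neighbourhood
  of \<open>x0\<close>, so the argument of the logarithm is always a positive real number.
\<close>

definition ftme ::
  "real set \<Rightarrow> (real \<Rightarrow> (real ^ 'n) set) \<Rightarrow> (real \<Rightarrow> real \<Rightarrow> real ^ 'n \<Rightarrow> real ^ 'n) \<Rightarrow>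
   real \<Rightarrow> real \<Rightarrow> real ^ 'n \<Rightarrow> ereal" where
  "ftme J X \<phi> \<alpha> t0 x0 =
     Limsup (at_right 0) (\<lambda>\<epsilon>.
       ereal (- (1 / (Max J - Min J)) *
         ln (measure lebesgue (ft_ball J X \<phi> \<alpha> t0 x0 \<epsilon>) / measure lebesgue (cball x0 \<epsilon>))))"

definition charpoly :: "'a::comm_ring_1 ^ 'n ^ 'n \<Rightarrow> 'a poly" where
  "charpoly A = det (mat [:0, 1:] - map_matrix (\<lambda>a. [:a:]) A)"

text \<open>
  The singular values of \<open>A\<close> in decreasing order: the square roots of the eigenvalues of
  \<open>A\<^sup>T A\<close>, each repeated according to its multiplicity as a root of the characteristic polynomial.
  As \<open>A\<^sup>T A\<close> is symmetric and positive semidefinite, all roots are real and non-negative, and the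
  list has length \<open>CARD('n)\<close>.
\<close>

definition singular_values :: "real ^ 'n ^ 'n \<Rightarrow> real list" where
  "singular_values A =
     rev (sorted_list_of_multiset (image_mset sqrt (proots (charpoly (transpose A ** A)))))"

text \<open>The index \<open>i\<close> ranges over \<open>{1..CARD('n)}\<close>, whereas list positions start at \<open>0\<close>.\<close>

definition ftle ::
  "(real \<Rightarrow> real \<Rightarrow> real ^ 'n \<Rightarrow> real ^ 'n) \<Rightarrow> nat \<Rightarrow> real \<Rightarrow> real ^ 'n \<Rightarrow> real \<Rightarrow> real" where
  "ftle \<phi> i t0 x0 T =
     1 / T * ln (singular_values (jacobian (\<phi> (t0 + T) t0) (at x0)) ! (i - 1))"

end

theory Submission
  imports Defs
begin

text \<open>
  Let \<open>A\<close> be the derivative of the time-\<open>T\<close> map at \<open>x0\<close>, and \<open>b = exp (- \<alpha> T)\<close>. Rescaled by \<open>\<epsilon>\<close>, the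
  sets \<open>ft_ball\<close> converge to \<open>E = {v. norm v \<le> 1 \<and> b * norm (A v) \<le> 1}\<close>, so the upper limit in the
  entropy is a limit, with value \<open>- ln (vol E / \<omega>) / T\<close>, where \<open>\<omega>\<close> is the volume of the unit ball.
  Diagonalising \<open>A\<^sup>T A\<close> by a rotation turns \<open>E\<close> into a set that lies between the ellipsoid with
  semi-axes \<open>1 / m i\<close> and the box with half-sides \<open>1 / m i\<close>, where \<open>m i = max 1 (b * \<Lambda> i)\<close> and
  \<open>ln (m i) / T\<close> is the positive part of the \<open>i\<close>-th Lyapunov exponent minus \<open>\<alpha>\<close>. Hence \<open>vol E\<close> lies
  between \<open>\<omega> / (\<Prod>i. m i)\<close> and \<open>2\<^sup>n / (\<Prod>i. m i)\<close>.
\<close>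

section \<open>Diagonalisation of symmetric matrices\<close>

text \<open>A maximiser \<open>v\<close> of the quadratic form of \<open>f\<close> on the unit
  sphere of \<open>S\<close> is an eigenvector: the residual \<open>w\<close> of the eigenvalue
  equation lies in \<open>S\<close> and is orthogonal to \<open>v\<close>, and if it were non-zero,
  moving \<open>v\<close> along it would raise the Rayleigh quotient.\<close>

lemma self_adjoint_eigenvector:
  fixes f :: "'a::euclidean_space \<Rightarrow> 'a"
  assumes lin: "linear f" and sym: "\<And>x y. f x \<bullet> y = x \<bullet> f y"
    and S: "subspace S" and inv: "f ` S \<subseteq> S" and nz: "S \<noteq> {0}"
  obtains v c where "v \<in> S" "norm v = 1" "f v = c *\<^sub>R v"
proof -
  let ?K = "S \<inter> sphere 0 1"
  obtain u where u: "u \<in> S" "u \<noteq> 0"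
    using nz S subspace_0 by blast
  have "u /\<^sub>R norm u \<in> ?K"
    using u S by (auto simp: subspace_scale)
  then have "?K \<noteq> {}" by blast
  moreover have "compact ?K"
    using S by (intro closed_Int_compact closed_subspace) auto
  moreover have "continuous_on ?K (\<lambda>x. x \<bullet> f x)"
    using lin by (intro continuous_intros linear_continuous_on linear_conv_bounded_linear[THEN iffD1])
  ultimately obtain v where v: "v \<in> ?K" and vmax: "\<And>x. x \<in> ?K \<Longrightarrow> x \<bullet> f x \<le> v \<bullet> f v"
    using continuous_attains_sup[of ?K "\<lambda>x. x \<bullet> f x"] by blast
  define c where "c = v \<bullet> f v"
  have vS: "v \<in> S" and nv: "norm v = 1" and vv: "v \<bullet> v = 1"
    using v by (auto simp: norm_eq_1)
  \<comment> \<open>By homogeneity the bound on the unit sphere extends to all of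
    \<open>S\<close>.\<close>
  have max: "x \<bullet> f x \<le> c * (x \<bullet> x)" if "x \<in> S" for x
  proof (cases "x = 0")
    case False
    let ?y = "x /\<^sub>R norm x"
    have "?y \<in> ?K" using False that S by (auto simp: subspace_scale)
    then have "?y \<bullet> f ?y \<le> c" unfolding c_def by (rule vmax)
    then have "(x \<bullet> f x) / (norm x)\<^sup>2 \<le> c"
      using lin by (simp add: linear_scale power2_eq_square field_simps)
    then show ?thesis using False
      by (simp add: divide_le_eq power2_norm_eq_inner)
  qed (use lin in \<open>simp add: linear_0\<close>)
  define w where "w = f v - c *\<^sub>R v"
  have wS: "w \<in> S" unfolding w_def
    using inv vS S by (intro subspace_diff subspace_scale) auto
  have wv: "w \<bullet> v = 0" unfolding w_def by (simp add: inner_diff_left vv c_def inner_commute[of "f v"])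
  define a b where "a = w \<bullet> f v" and "b = w \<bullet> f w - c * (w \<bullet> w)"
  \<comment> \<open>This is \<open>max\<close> at \<open>v + t *\<^sub>R w\<close>; the terms of
    order zero cancel. A quadratic in \<open>t\<close> without constant term that is never positive
    has no linear term, so \<open>a\<close> must vanish.\<close>
  have quad: "2 * t * a + t\<^sup>2 * b \<le> 0" for t
  proof -
    have "v + t *\<^sub>R w \<in> S" using vS wS S by (simp add: subspace_add subspace_scale)
    from max[OF this] have "(v + t *\<^sub>R w) \<bullet> f (v + t *\<^sub>R w) \<le> c * ((v + t *\<^sub>R w) \<bullet> (v + t *\<^sub>R w))" .
    moreover have "v \<bullet> f w = a" using sym[of w v] by (simp add: a_def inner_commute[of v])
    moreover have "v \<bullet> w = 0" using wv by (simp add: inner_commute)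
    ultimately show ?thesis
      using wv lin
      by (simp add: linear_add linear_scale inner_add_left inner_add_right c_def[symmetric] vv
          a_def[symmetric] b_def power2_eq_square algebra_simps)
  qed
  have "a = 0"
  proof (rule ccontr)
    assume "a \<noteq> 0"
    \<comment> \<open>The sign of \<open>?t\<close> makes the linear term positive, and the
      denominator makes \<open>?t\<close> small enough for that term to dominate whatever the sign
      of \<open>b\<close>.\<close>
    let ?t = "a / (\<bar>b\<bar> + 1)"
    have p: "\<bar>b\<bar> + 1 > 0" by simp
    have "2 * ?t * a + ?t\<^sup>2 * b = (a\<^sup>2 / (\<bar>b\<bar> + 1)\<^sup>2) * (2 * (\<bar>b\<bar> + 1) + b)"
      using p by (simp add: power2_eq_square divide_simps) (simp add: algebra_simps)
    moreover have "a\<^sup>2 / (\<bar>b\<bar> + 1)\<^sup>2 > 0" using \<open>a \<noteq> 0\<close> p by (simp add: zero_less_divide_iff)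
    moreover have "2 * (\<bar>b\<bar> + 1) + b > 0"
      by (cases "b \<ge> 0") auto
    ultimately have "2 * ?t * a + ?t\<^sup>2 * b > 0" by (metis mult_pos_pos)
    with quad[of ?t] show False by linarith
  qed
  moreover have "w \<bullet> w = a - c * (w \<bullet> v)"
    unfolding a_def by (subst (2) w_def) (simp add: inner_diff_right)
  ultimately have "w \<bullet> w = 0" using wv by simp
  then have "f v = c *\<^sub>R v" by (simp add: w_def)
  with vS nv show thesis by (rule that)
qed

text \<open>Induction on the dimension: after splitting off a unit eigenvector \<open>v\<close>, its
  orthogonal complement in \<open>S\<close> is again invariant because \<open>f\<close> is
  self-adjoint, and it has smaller dimension.\<close>

lemma self_adjoint_orthonormal_eigenbasis:
  fixes f :: "'a::euclidean_space \<Rightarrow> 'a"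
  assumes lin: "linear f" and sym: "\<And>x y. f x \<bullet> y = x \<bullet> f y"
  shows "subspace S \<Longrightarrow> f ` S \<subseteq> S \<Longrightarrow>
    \<exists>B. B \<subseteq> S \<and> S \<subseteq> span B \<and> pairwise orthogonal B \<and> (\<forall>v\<in>B. norm v = 1 \<and> (\<exists>c. f v = c *\<^sub>R v))"
proof (induction "dim S" arbitrary: S rule: less_induct)
  case (less S)
  show ?case
  proof (cases "S = {0}")
    case True
    then show ?thesis by (intro exI[of _ "{}"]) auto
  next
    case False
    obtain v c where v: "v \<in> S" "norm v = 1" "f v = c *\<^sub>R v"
      using self_adjoint_eigenvector[OF lin sym less.prems False] by blast
    define S' where "S' = S \<inter> {x. v \<bullet> x = 0}"
    have sub: "subspace S'"
      unfolding S'_def using less.prems(1) by (simp add: subspace_inter subspace_hyperplane)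
    have "v \<bullet> f x = 0" if "v \<bullet> x = 0" for x
      using that v(3) by (simp flip: sym)
    then have inv: "f ` S' \<subseteq> S'"
      using less.prems(2) unfolding S'_def by auto
    have "v \<notin> S'" using v(2) unfolding S'_def by auto
    then have "S' \<subset> S" using v(1) unfolding S'_def by blast
    then have "dim S' < dim S"
      using sub less.prems(1) by (intro dim_psubset) (simp add: span_eq_iff[THEN iffD2])
    from less.hyps[OF this sub inv] obtain B where B: "B \<subseteq> S'" "S' \<subseteq> span B" "pairwise orthogonal B"
      "\<forall>v\<in>B. norm v = 1 \<and> (\<exists>c. f v = c *\<^sub>R v)" by blast
    have "x \<in> span (insert v B)" if "x \<in> S" for x
    proof -
      have "x - (v \<bullet> x) *\<^sub>R v \<in> S'"
        using that v less.prems(1) unfolding S'_def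
        by (auto simp: subspace_diff subspace_scale inner_diff_right norm_eq_1)
      then show ?thesis using B(2) unfolding span_insert by blast
    qed
    moreover have "pairwise orthogonal (insert v B)"
      using B(1,3) unfolding S'_def pairwise_insert by (auto simp: orthogonal_def inner_commute)
    moreover have "insert v B \<subseteq> S" using B(1) v(1) unfolding S'_def by auto
    ultimately show ?thesis using B(4) v(2,3) by (intro exI[of _ "insert v B"]) auto
  qed
qed

definition diag_matrix :: "('n \<Rightarrow> 'a::zero) \<Rightarrow> 'a ^ 'n ^ 'n" where
  "diag_matrix d = (\<chi> i j. if i = j then d i else 0)"

text \<open>The columns of \<open>P\<close> are orthonormal eigenvectors \<open>b j\<close>, so the
  entries of the conjugated matrix are the inner products of \<open>b i\<close> with
  \<open>M *v b j\<close>.\<close>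

theorem symmetric_matrix_diagonalizable:
  fixes M :: "real ^ 'n ^ 'n"
  assumes "transpose M = M"
  obtains P d where "orthogonal_matrix P" "transpose P ** M ** P = diag_matrix d"
proof -
  have lin: "linear ((*v) M)" by simp
  have sym: "(M *v x) \<bullet> y = x \<bullet> (M *v y)" for x y
    by (metis assms dot_lmul_matrix transpose_matrix_vector)
  obtain B where B: "UNIV \<subseteq> span B" "pairwise orthogonal B"
      "\<forall>v\<in>B. norm v = 1 \<and> (\<exists>c. M *v v = c *\<^sub>R v)"
    using self_adjoint_orthonormal_eigenbasis[OF lin sym, of UNIV] by auto
  \<comment> \<open>Non-zero orthogonal vectors are independent, so \<open>B\<close> is a basis of
    \<open>CARD('n)\<close> elements and can be indexed by \<open>'n\<close>.\<close>
  have "0 \<notin> B" using B(3) by force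
  then have ind: "independent B" using B(2) pairwise_orthogonal_independent by blast
  then have "card B = CARD('n)"
    using B(1) by (metis DIM_cart DIM_real basis_card_eq_dim dim_UNIV mult.right_neutral subset_UNIV)
  moreover have "finite B" using ind by (rule independent_imp_finite)
  ultimately obtain b :: "'n \<Rightarrow> real ^ 'n" where b: "bij_betw b UNIV B"
    by (metis finite_same_card_bij finite)
  have bB: "b i \<in> B" for i using b by (auto simp: bij_betw_def)
  have orth: "b i \<bullet> b j = (if i = j then 1 else 0)" for i j
  proof (cases "i = j")
    case True
    then show ?thesis using B(3) bB norm_eq_1 by auto
  next
    case False
    then have "b i \<noteq> b j" using b by (auto simp: bij_betw_def inj_def)
    then show ?thesis using B(2) bB False by (auto simp: pairwise_def orthogonal_def)
  qed
  have "\<forall>i. \<exists>c. M *v b i = c *\<^sub>R b i" using B(3) bB by blast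
  then obtain d where d: "\<And>i. M *v b i = d i *\<^sub>R b i" by (auto dest!: choice)
  define P where "P = (\<chi> i j. b j $ i)"
  have col: "column j P = b j" for j by (simp add: P_def column_def vec_eq_iff)
  have "orthogonal_matrix P"
    unfolding orthogonal_matrix_orthonormal_columns col
    using orth by (simp add: norm_eq_1 orthogonal_def)
  moreover have "transpose P ** M ** P = diag_matrix d"
  proof -
    have "(transpose P ** (M ** P)) $ i $ j = diag_matrix d $ i $ j" for i j
    proof -
      have "(M ** P) $ k $ j = (M *v b j) $ k" for k
        by (simp add: matrix_matrix_mult_def matrix_vector_mult_def P_def)
      then have "(transpose P ** (M ** P)) $ i $ j = b i \<bullet> (M *v b j)"
        unfolding matrix_matrix_mult_def[of "transpose P" "M ** P"] inner_vec_def
        by (simp add: transpose_def) (simp add: P_def)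
      then show ?thesis by (simp add: d orth diag_matrix_def)
    qed
    then show ?thesis by (simp add: vec_eq_iff matrix_mul_assoc)
  qed
  ultimately show thesis by (rule that)
qed

section \<open>Singular values\<close>

text \<open>Lifts a conjugation of matrices to the polynomial ring, where the characteristic matrix
  lives.\<close>

lemma map_matrix_const_poly_mult:
  fixes A B :: "'a::comm_ring_1 ^ 'n ^ 'n"
  shows "map_matrix (\<lambda>a. [:a:]) (A ** B) = map_matrix (\<lambda>a. [:a:]) A ** map_matrix (\<lambda>a. [:a:]) B"
proof -
  have "[:sum g S:] = (\<Sum>x\<in>S. [:g x:])" for g :: "'n \<Rightarrow> 'a" and S
  proof (induction S rule: infinite_finite_induct)
    case (insert x S)
    then show ?case by (simp del: insert.IH flip: insert.IH)
  qed simp_all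
  then show ?thesis by (simp add: vec_eq_iff matrix_matrix_mult_def mult.commute)
qed

lemma matrix_diff_ldistrib: "A ** (B - C) = A ** B - A ** (C :: 'a::ring_1 ^ 'n ^ 'm)"
  by (simp add: vec_eq_iff matrix_matrix_mult_def right_diff_distrib sum_subtractf)

lemma matrix_diff_rdistrib: "(A - B) ** C = A ** C - B ** (C :: 'a::ring_1 ^ 'n ^ 'm)"
  by (simp add: vec_eq_iff matrix_matrix_mult_def left_diff_distrib sum_subtractf)

lemma mat_commute: "mat c ** A = A ** mat (c::'a::comm_semiring_1)"
  by (simp add: vec_eq_iff matrix_matrix_mult_def mat_def if_distrib if_distribR
      mult.commute cong: if_cong)

text \<open>The scalar matrix \<open>mat [:0, 1:]\<close> is unchanged by conjugation, so the whole
  characteristic matrix is conjugated by the constant lifts of \<open>P\<close> and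
  \<open>Q\<close>, whose determinants multiply to 1.\<close>

lemma charpoly_similar:
  fixes M P Q :: "'a::comm_ring_1 ^ 'n ^ 'n"
  assumes PQ: "P ** Q = mat 1" and QP: "Q ** P = mat 1"
  shows "charpoly (Q ** M ** P) = charpoly M"
proof -
  let ?c = "map_matrix (\<lambda>a. [:a:]) :: 'a ^ 'n ^ 'n \<Rightarrow> _"
  have one: "?c (mat 1) = mat 1"
    by (simp add: vec_eq_iff mat_def one_pCons)
  have "mat [:0, 1:] - ?c (Q ** M ** P) = ?c Q ** (mat [:0, 1:] - ?c M) ** ?c P"
  proof -
    have "?c Q ** mat [:0, 1:] ** ?c P = mat [:0, 1:] ** ?c (Q ** P)"
      by (simp add: mat_commute[symmetric] matrix_mul_assoc[symmetric] map_matrix_const_poly_mult)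
    then have "?c Q ** mat [:0, 1:] ** ?c P = mat [:0, 1:]" by (simp add: QP one)
    then show ?thesis
      by (simp add: map_matrix_const_poly_mult matrix_diff_ldistrib matrix_diff_rdistrib)
  qed
  then have "charpoly (Q ** M ** P) = det (?c Q) * det (?c P) * charpoly M"
    by (simp add: charpoly_def det_mul)
  moreover have "det (?c Q) * det (?c P) = 1"
    by (simp flip: det_mul map_matrix_const_poly_mult add: QP one)
  ultimately show ?thesis by simp
qed

lemma charpoly_diag_matrix: "charpoly (diag_matrix d) = (\<Prod>i\<in>UNIV. [:- d i, 1:])"
  unfolding charpoly_def by (subst det_diagonal) (auto simp: diag_matrix_def mat_def)

lemma proots_charpoly_diag_matrix:
  fixes d :: "'n::finite \<Rightarrow> 'a::idom"
  shows "proots (charpoly (diag_matrix d)) = image_mset d (mset_set UNIV)"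
proof -
  have "proots (\<Prod>i\<in>S. [:- d i, 1:]) = image_mset d (mset_set S)" if "finite S" for S
    using that
  proof (induction S rule: finite_induct)
    case (insert i S)
    have "(\<Prod>i\<in>S. [:- d i, 1:]) \<noteq> 0" using insert by simp
    then show ?case using insert by (simp add: proots_mult del: mult_pCons_left)
  qed simp
  then show ?thesis by (simp add: charpoly_diag_matrix)
qed

text \<open>As \<open>transpose P\<close> inverts \<open>P\<close>, the characteristic polynomial is
  that of \<open>diag_matrix d\<close>, with roots \<open>d i\<close>. Only multisets are compared,
  because \<open>d\<close> comes in no particular order.\<close>

lemma singular_values_diagonalized:
  fixes A P :: "real ^ 'n ^ 'n"
  assumes "orthogonal_matrix P" "transpose P ** (transpose A ** A) ** P = diag_matrix d"
  shows "mset (singular_values A) = image_mset (\<lambda>i. sqrt (d i)) (mset_set UNIV)"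
proof -
  have c: "charpoly (transpose A ** A) = charpoly (diag_matrix d)"
    unfolding assms(2)[symmetric]
    using assms(1) by (intro charpoly_similar[symmetric]) (auto simp: orthogonal_matrix_def)
  then show ?thesis
    by (simp add: singular_values_def c proots_charpoly_diag_matrix image_mset.compositionality comp_def)
qed

text \<open>Such a sum does not depend on the order, so the sorted list can be traded for the family
  indexed by \<open>'n\<close>.\<close>

lemma sum_singular_values_diagonalized:
  fixes A P :: "real ^ 'n ^ 'n" and F :: "real \<Rightarrow> 'b::comm_monoid_add"
  assumes "orthogonal_matrix P" "transpose P ** (transpose A ** A) ** P = diag_matrix d"
  shows "(\<Sum>i = 1..CARD('n). F (singular_values A ! (i - 1))) = (\<Sum>i\<in>UNIV. F (sqrt (d i)))"
proof -
  note m = singular_values_diagonalized[OF assms]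
  have len: "length (singular_values A) = CARD('n)"
    using arg_cong[OF m, of size] by simp
  have "(\<Sum>i = 1..CARD('n). F (singular_values A ! (i - 1)))
      = (\<Sum>i<CARD('n). F (singular_values A ! i))"
    by (rule sum.reindex_bij_witness[of _ Suc "\<lambda>i. i - 1"]) auto
  also have "\<dots> = sum_list (map F (singular_values A))"
    by (simp add: sum_list_sum_nth len atLeast0LessThan)
  also have "\<dots> = sum_mset (image_mset F (mset (singular_values A)))"
    by (simp flip: sum_mset_sum_list)
  also have "\<dots> = (\<Sum>i\<in>UNIV. F (sqrt (d i)))"
    by (simp add: m image_mset.compositionality comp_def sum_unfold_sum_mset)
  finally show ?thesis .
qed

lemma norm_diagonalized:
  fixes A P :: "real ^ 'n ^ 'n"
  assumes "transpose P ** (transpose A ** A) ** P = diag_matrix d"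
  shows "(norm (A *v (P *v w)))\<^sup>2 = (\<Sum>i\<in>UNIV. d i * (w $ i)\<^sup>2)"
proof -
  have "(norm (A *v (P *v w)))\<^sup>2 = w \<bullet> ((transpose P ** (transpose A ** A) ** P) *v w)"
    unfolding power2_norm_eq_inner
    by (metis dot_lmul_matrix matrix_vector_mul_assoc transpose_matrix_vector transpose_transpose)
  also have "\<dots> = (\<Sum>i\<in>UNIV. d i * (w $ i)\<^sup>2)"
    unfolding assms
    by (simp add: diag_matrix_def inner_vec_def matrix_vector_mult_def if_distrib if_distribR
        power2_eq_square mult_ac cong: if_cong)
  finally show ?thesis .
qed

text \<open>The number \<open>d i\<close> is the squared norm of the image under \<open>A\<close> of
  the \<open>i\<close>-th column of \<open>P\<close>, which is non-zero.\<close>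

lemma diagonalized_pos:
  fixes A P :: "real ^ 'n ^ 'n"
  assumes P: "orthogonal_matrix P" and D: "transpose P ** (transpose A ** A) ** P = diag_matrix d"
    and A: "\<And>v. A *v v = 0 \<Longrightarrow> v = 0"
  shows "d i > 0"
proof -
  let ?e = "axis i 1 :: real ^ 'n"
  have "P *v ?e \<noteq> 0"
    using P by (metis axis_eq_0_iff matrix_vector_mul_assoc matrix_vector_mul_lid
        matrix_vector_mult_0_right orthogonal_matrix_def zero_neq_one)
  then have "A *v (P *v ?e) \<noteq> 0" using A by blast
  then have "0 < (norm (A *v (P *v ?e)))\<^sup>2" by simp
  also have "\<dots> = d i"
    unfolding norm_diagonalized[OF D]
    by (simp add: axis_def if_distrib if_distribR power2_eq_square cong: if_cong)
  finally show ?thesis .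
qed


section \<open>Volume of the linearised Bowen ball\<close>

text \<open>The weight \<open>(m i)\<^sup>2\<close> is the larger of the coefficients 1 and
  \<open>d i\<close> of the two quadratic forms that define \<open>E\<close>. Hence the stretch by
  \<open>1 / m i\<close> maps the unit ball into \<open>E\<close>, and \<open>E\<close> lies in the
  box with half-sides \<open>1 / m i\<close>.\<close>

lemma measure_ball_Int_ellipsoid_diag:
  fixes d :: "'n::finite \<Rightarrow> real"
  assumes d: "\<And>i. d i \<ge> 0"
  defines "E \<equiv> {w :: real ^ 'n. norm w \<le> 1 \<and> (\<Sum>i\<in>UNIV. d i * (w $ i)\<^sup>2) \<le> 1}"
    and "m \<equiv> \<lambda>i. max 1 (sqrt (d i))"
  shows "E \<in> lmeasurable"
    and "unit_ball_vol (real CARD('n)) / (\<Prod>i\<in>UNIV. m i) \<le> measure lebesgue E"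
    and "measure lebesgue E \<le> 2 ^ CARD('n) / (\<Prod>i\<in>UNIV. m i)"
proof -
  have m1: "m i \<ge> 1" and m0: "m i > 0" for i by (auto simp: m_def)
  have msq: "(m i)\<^sup>2 = max 1 (d i)" for i
    using d[of i] by (auto simp: m_def max_def)
  have norm2: "(norm w)\<^sup>2 = (\<Sum>i\<in>UNIV. (w $ i)\<^sup>2)" for w :: "real ^ 'n"
    unfolding power2_norm_eq_inner inner_vec_def by (simp add: power2_eq_square)
  have norm1: "norm w \<le> 1 \<longleftrightarrow> (\<Sum>i\<in>UNIV. (w $ i)\<^sup>2) \<le> 1" for w :: "real ^ 'n"
    by (simp add: norm2[symmetric] abs_square_le_1)
  have "closed E" unfolding E_def by (intro closed_Collect_conj closed_Collect_le continuous_intros)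
  moreover have "bounded E" unfolding E_def bounded_iff by blast
  ultimately show meas: "E \<in> lmeasurable" by (simp add: lmeasurable_compact compact_eq_bounded_closed)
  let ?s = "\<lambda>x::real ^ 'n. \<chi> k. (1 / m k) * x $ k"
  have "?s ` cball 0 1 \<subseteq> E"
  proof (intro subsetI, elim imageE)
    fix w x assume w: "w = ?s x" and x: "x \<in> cball 0 1"
    \<comment> \<open>Applied with \<open>c = 1\<close> for the norm condition and with
      \<open>c = d i\<close> for the other one.\<close>
    have le: "c * (w $ i)\<^sup>2 \<le> (x $ i)\<^sup>2" if "c \<le> (m i)\<^sup>2" for c i
    proof -
      have "c * (w $ i)\<^sup>2 \<le> (m i)\<^sup>2 * (w $ i)\<^sup>2" using that by (rule mult_right_mono) simp
      also have "\<dots> = (x $ i)\<^sup>2" using m0[of i] by (simp add: w field_simps)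
      finally show ?thesis .
    qed
    have "(\<Sum>i\<in>UNIV. (x $ i)\<^sup>2) \<le> 1" using x norm1 by simp
    moreover have "(\<Sum>i\<in>UNIV. (w $ i)\<^sup>2) \<le> (\<Sum>i\<in>UNIV. (x $ i)\<^sup>2)"
      using le[of 1] msq by (intro sum_mono) simp
    moreover have "(\<Sum>i\<in>UNIV. d i * (w $ i)\<^sup>2) \<le> (\<Sum>i\<in>UNIV. (x $ i)\<^sup>2)"
      using msq by (intro sum_mono le) simp
    ultimately show "w \<in> E" unfolding E_def using norm1 by simp
  qed
  moreover have "?s ` cball 0 1 \<in> lmeasurable" by (intro measurable_stretch) simp
  ultimately have "measure lebesgue (?s ` cball 0 1) \<le> measure lebesgue E"
    using meas by (intro measure_mono_fmeasurable) (auto intro: fmeasurableD)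
  also have "measure lebesgue (?s ` cball 0 1)
      = \<bar>\<Prod>i\<in>UNIV. 1 / m i\<bar> * measure lebesgue (cball (0 :: real ^ 'n) 1)"
    by (rule measure_stretch) simp
  also have "\<dots> = unit_ball_vol (real CARD('n)) / (\<Prod>i\<in>UNIV. m i)"
    using m0 by (simp add: prod_dividef content_cball abs_prod less_imp_le)
  finally show "unit_ball_vol (real CARD('n)) / (\<Prod>i\<in>UNIV. m i) \<le> measure lebesgue E" .
  let ?B = "cbox (\<chi> i. - (1 / m i)) (\<chi> i. 1 / m i) :: (real ^ 'n) set"
  have "E \<subseteq> ?B"
  proof
    fix w assume w: "w \<in> E"
    have "\<bar>w $ i\<bar> \<le> 1 / m i" for i
    proof -
      have "(w $ i)\<^sup>2 \<le> (\<Sum>i\<in>UNIV. (w $ i)\<^sup>2)" by (rule member_le_sum) auto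
      moreover have "d i * (w $ i)\<^sup>2 \<le> (\<Sum>i\<in>UNIV. d i * (w $ i)\<^sup>2)"
        by (rule member_le_sum) (auto simp: d)
      \<comment> \<open>Whichever of 1 and \<open>d i\<close> is the maximum, one of the two sums
        bounds the left-hand side.\<close>
      ultimately have "(m i)\<^sup>2 * (w $ i)\<^sup>2 \<le> 1"
        using w unfolding E_def msq norm1 by (auto simp: max_def)
      then have "\<bar>m i * w $ i\<bar> \<le> 1" by (simp flip: power_mult_distrib add: abs_square_le_1)
      then show ?thesis using m0[of i] by (simp add: abs_mult field_simps)
    qed
    then show "w \<in> ?B" by (auto simp: mem_box_cart abs_le_iff minus_le_iff)
  qed
  then have "measure lebesgue E \<le> measure lebesgue ?B"
    using meas by (intro measure_mono_fmeasurable) auto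
  also have "\<dots> = (\<Prod>i\<in>UNIV. 2 / m i)"
    using m0 by (simp add: content_cbox_cart interval_ne_empty_cart less_imp_le)
  also have "\<dots> = 2 ^ CARD('n) / (\<Prod>i\<in>UNIV. m i)" by (simp add: prod_dividef)
  finally show "measure lebesgue E \<le> 2 ^ CARD('n) / (\<Prod>i\<in>UNIV. m i)" .
qed

text \<open>
  Integrate \<open>1\<^sub>K x * 1\<^sub>B (x + Q z)\<close>, where \<open>K\<close> is the unit ball, in both orders. By translation
  invariance and \<open>Q -` K = K\<close> this gives \<open>vol K * vol (Q -` B) = vol K * vol B\<close>. The library version
  \<open>measure_orthogonal_image\<close> requires a well-ordered index type.
\<close>

lemma emeasure_orthogonal_vimage:
  fixes Q :: "'a::euclidean_space \<Rightarrow> 'a"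
  assumes Q: "orthogonal_transformation Q" and B [measurable]: "B \<in> sets borel"
  shows "emeasure lborel (Q -` B) = emeasure lborel B"
proof -
  \<comment> \<open>The inverse brings translations inside \<open>Q\<close>:
    \<open>x + Q z = Q (R x + z)\<close> and \<open>x - Q z = Q (R x - z)\<close>.\<close>
  define R where "R = inv Q"
  have QR: "Q (R x) = x" for x
    unfolding R_def using orthogonal_transformation_surj[OF Q] by (simp add: surj_f_inv_f)
  have lin: "linear Q" using Q by (rule orthogonal_transformation_linear)
  have [measurable]: "Q \<in> borel_measurable borel"
    using lin by (intro borel_measurable_continuous_onI linear_continuous_on)
      (simp add: linear_conv_bounded_linear)
  define K where "K = cball (0 :: 'a) 1"
  have [measurable]: "K \<in> sets borel" by (simp add: K_def)
  have translate: "(\<integral>\<^sup>+x. g (c + x) \<partial>lborel) = (\<integral>\<^sup>+x. g x \<partial>lborel)"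
    if [measurable]: "g \<in> borel_measurable borel" for g :: "'a \<Rightarrow> ennreal" and c
    by (subst (2) lborel_distr_plus[of c, symmetric]) (simp add: nn_integral_distr)
  let ?I = "\<lambda>x z. indicator K x * indicator B (x + Q z) :: ennreal"
  have "(\<integral>\<^sup>+x. (\<integral>\<^sup>+z. ?I x z \<partial>lborel) \<partial>lborel) = (\<integral>\<^sup>+x. indicator K x * emeasure lborel (Q -` B) \<partial>lborel)"
  proof (rule nn_integral_cong)
    fix x
    have "(\<integral>\<^sup>+z. indicator B (x + Q z) \<partial>lborel) = (\<integral>\<^sup>+z. indicator B (Q (R x + z)) \<partial>lborel)"
      by (simp add: linear_add[OF lin] QR)
    also have "\<dots> = (\<integral>\<^sup>+z. indicator B (Q z) \<partial>lborel)"
      by (rule translate) measurable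
    also have "\<dots> = (\<integral>\<^sup>+z. indicator (Q -` B) z \<partial>lborel)"
      by (intro nn_integral_cong) (simp add: indicator_def)
    also have "\<dots> = emeasure lborel (Q -` B)"
      using measurable_sets[of Q borel borel B] by (intro nn_integral_indicator) simp
    finally show "(\<integral>\<^sup>+z. ?I x z \<partial>lborel) = indicator K x * emeasure lborel (Q -` B)"
      by (simp add: nn_integral_cmult)
  qed
  also have "\<dots> = emeasure lborel K * emeasure lborel (Q -` B)"
    by (simp add: nn_integral_multc)
  finally have 1: "(\<integral>\<^sup>+x. (\<integral>\<^sup>+z. ?I x z \<partial>lborel) \<partial>lborel) = emeasure lborel K * emeasure lborel (Q -` B)" .
  have "(\<integral>\<^sup>+x. (\<integral>\<^sup>+z. ?I x z \<partial>lborel) \<partial>lborel) = (\<integral>\<^sup>+z. (\<integral>\<^sup>+x. ?I x z \<partial>lborel) \<partial>lborel)"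
    by (rule lborel_pair.Fubini'[symmetric]) measurable
  also have "\<dots> = (\<integral>\<^sup>+z. (\<integral>\<^sup>+x. indicator K (x - Q z) * indicator B x \<partial>lborel) \<partial>lborel)"
  proof (rule nn_integral_cong)
    fix z
    show "(\<integral>\<^sup>+x. ?I x z \<partial>lborel) = (\<integral>\<^sup>+x. indicator K (x - Q z) * indicator B x \<partial>lborel)"
      using translate[of "\<lambda>x. indicator K (x - Q z) * indicator B x" "Q z"] by (simp add: add.commute)
  qed
  also have "\<dots> = (\<integral>\<^sup>+x. (\<integral>\<^sup>+z. indicator K (x - Q z) * indicator B x \<partial>lborel) \<partial>lborel)"
    by (rule lborel_pair.Fubini') measurable
  also have "\<dots> = (\<integral>\<^sup>+x. emeasure lborel K * indicator B x \<partial>lborel)"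
  proof (rule nn_integral_cong)
    fix x
    have "norm (x - Q z) = dist (R x) z" for z
      using orthogonal_transformation_norm[OF Q, of "R x - z"] by (simp add: linear_diff[OF lin] QR dist_norm)
    then have "(\<integral>\<^sup>+z. indicator K (x - Q z) \<partial>lborel) = (\<integral>\<^sup>+z. indicator (cball (R x) 1) z \<partial>lborel)"
      by (intro nn_integral_cong) (simp add: indicator_def K_def)
    also have "\<dots> = emeasure lborel K" by (simp add: K_def emeasure_cball)
    finally show "(\<integral>\<^sup>+z. indicator K (x - Q z) * indicator B x \<partial>lborel) = emeasure lborel K * indicator B x"
      by (simp add: nn_integral_multc)
  qed
  also have "\<dots> = emeasure lborel K * emeasure lborel B" by (simp add: nn_integral_cmult)
  finally have "emeasure lborel K * emeasure lborel (Q -` B) = emeasure lborel K * emeasure lborel B"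
    using 1 by simp
  \<comment> \<open>The factor can be cancelled because the volume of the ball is neither zero nor
    infinite.\<close>
  moreover have "emeasure lborel K = ennreal (unit_ball_vol (real DIM('a)))"
    by (simp add: K_def emeasure_cball)
  ultimately show ?thesis
    using less_imp_neq[OF unit_ball_vol_pos[of "real DIM('a)"]]
    by (subst (asm) ennreal_mult_cancel_left) auto
qed

lemma measure_orthogonal_vimage:
  fixes Q :: "'a::euclidean_space \<Rightarrow> 'a"
  assumes Q: "orthogonal_transformation Q" and B: "B \<in> sets borel"
  shows "measure lebesgue (Q -` B) = measure lebesgue B"
proof -
  have "Q \<in> borel_measurable borel"
    using orthogonal_transformation_linear[OF Q]
    by (intro borel_measurable_continuous_onI linear_continuous_on) (simp add: linear_conv_bounded_linear)
  then have "Q -` B \<in> sets borel" using measurable_sets[of Q borel borel B] B by simp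
  then show ?thesis
    using emeasure_orthogonal_vimage[OF Q B] B by (simp add: measure_def)
qed

text \<open>The substitution \<open>v = P *v w\<close> preserves volume and diagonalises the second
  condition, with \<open>b\<close> turning \<open>d i\<close> into \<open>b\<^sup>2 * d i\<close>.
  This reduces the claim to the diagonal case.\<close>

lemma measure_ball_Int_ellipsoid:
  fixes A P :: "real ^ 'n ^ 'n" and b :: real
  assumes P: "orthogonal_matrix P" and D: "transpose P ** (transpose A ** A) ** P = diag_matrix d"
    and b: "b \<ge> 0" and d: "\<And>i. d i \<ge> 0"
  defines "E \<equiv> {v. norm v \<le> 1 \<and> b * norm (A *v v) \<le> 1}"
    and "m \<equiv> \<lambda>i. max 1 (b * sqrt (d i))"
  shows "unit_ball_vol (real CARD('n)) / (\<Prod>i\<in>UNIV. m i) \<le> measure lebesgue E"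
    and "measure lebesgue E \<le> 2 ^ CARD('n) / (\<Prod>i\<in>UNIV. m i)"
proof -
  define E' where "E' = {w :: real ^ 'n. norm w \<le> 1 \<and> (\<Sum>i\<in>UNIV. (b\<^sup>2 * d i) * (w $ i)\<^sup>2) \<le> 1}"
  have orth: "orthogonal_transformation ((*v) P)"
    using P by (simp add: orthogonal_transformation_matrix)
  have iff: "w \<in> E' \<longleftrightarrow> P *v w \<in> E" for w
  proof -
    have "(\<Sum>i\<in>UNIV. (b\<^sup>2 * d i) * (w $ i)\<^sup>2) = (b * norm (A *v (P *v w)))\<^sup>2"
      by (simp add: power_mult_distrib norm_diagonalized[OF D] sum_distrib_left mult.assoc)
    then show ?thesis
      using orth b unfolding E'_def E_def
      by (auto simp: abs_square_le_1 orthogonal_transformation_norm abs_mult)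
  qed
  have "closed E"
    unfolding E_def by (intro closed_Collect_conj closed_Collect_le continuous_intros)
  moreover have "E' = (*v) P -` E" using iff by blast
  ultimately have "measure lebesgue E = measure lebesgue E'"
    using measure_orthogonal_vimage[OF orth, of E] by simp
  moreover have "max 1 (sqrt (b\<^sup>2 * d i)) = m i" for i
    using b by (simp add: m_def real_sqrt_mult)
  moreover note vol = measure_ball_Int_ellipsoid_diag[of "\<lambda>i. b\<^sup>2 * d i", folded E'_def]
  ultimately show "unit_ball_vol (real CARD('n)) / (\<Prod>i\<in>UNIV. m i) \<le> measure lebesgue E"
    and "measure lebesgue E \<le> 2 ^ CARD('n) / (\<Prod>i\<in>UNIV. m i)"
    using vol(2,3) d by simp_all
qed

section \<open>Asymptotic volume of small Bowen balls of a differentiable map\<close>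

text \<open>Differentiability replaces \<open>f\<close> by \<open>A\<close> with arbitrarily small
  relative error, so \<open>B \<epsilon>\<close> is close to the copy of \<open>E\<close> scaled by
  \<epsilon> about \<open>x0\<close>; its volume and that of the ball scale by the same power of
  \<epsilon>.\<close>

lemma measure_Bowen_ball_tendsto:
  fixes f :: "'a::euclidean_space \<Rightarrow> 'b::real_normed_vector"
  assumes U: "open U" "x0 \<in> U" and cont: "continuous_on U f"
    and der: "(f has_derivative A) (at x0)" and b: "b \<ge> 0"
  defines "B \<equiv> \<lambda>\<epsilon>. {x \<in> U. norm (x - x0) \<le> \<epsilon> \<and> b * norm (f x - f x0) \<le> \<epsilon>}"
    and "E \<equiv> {v. norm v \<le> 1 \<and> b * norm (A v) \<le> 1}"
  shows "((\<lambda>\<epsilon>. measure lebesgue (B \<epsilon>) / measure lebesgue (cball x0 \<epsilon>)) \<longlongrightarrow>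
    measure lebesgue E / unit_ball_vol (real DIM('a))) (at_right 0)"
proof -
  let ?n = "DIM('a)"
  let ?L = "measure lebesgue E / unit_ball_vol (real ?n)"
  have lin: "linear A" and blin: "bounded_linear A"
    using der by (auto simp: has_derivative_linear has_derivative_bounded_linear)
  have "continuous_on UNIV A" using blin by (rule linear_continuous_on)
  then have "closed E" unfolding E_def by (intro closed_Collect_conj closed_Collect_le continuous_intros)
  moreover have "bounded E" unfolding E_def bounded_iff by blast
  ultimately have Ecomp: "compact E" by (simp add: compact_eq_bounded_closed)
  \<comment> \<open>Continuity on \<open>U\<close> makes the second condition relatively closed in
    the open set \<open>U\<close>; the first one confines \<open>B \<epsilon>\<close> to a
    ball.\<close>
  have Bmeas: "B \<epsilon> \<in> lmeasurable" for \<epsilon>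
  proof -
    have "closedin (top_of_set U) (U \<inter> (\<lambda>x. b * norm (f x - f x0)) -` {..\<epsilon>})"
      by (intro continuous_closedin_preimage continuous_intros cont closed_atMost)
    then obtain T where T: "closed T" "U \<inter> (\<lambda>x. b * norm (f x - f x0)) -` {..\<epsilon>} = U \<inter> T"
      by (auto simp: closedin_closed)
    have "B \<epsilon> = (U \<inter> T) \<inter> cball x0 \<epsilon>"
      unfolding T(2)[symmetric] B_def by (auto simp: dist_norm norm_minus_commute)
    moreover have "U \<inter> T \<in> sets lebesgue"
      using U(1) T(1) by (intro sets.Int) auto
    ultimately show ?thesis
      by (metis fmeasurable_Int_fmeasurable inf_commute lmeasurable_cball)
  qed
  have dil: "measure lebesgue ((\<lambda>v. x0 + r *\<^sub>R v) ` E) = r ^ ?n * measure lebesgue E"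
    "(\<lambda>v. x0 + r *\<^sub>R v) ` E \<in> lmeasurable" if "r > 0" for r
  proof -
    show "measure lebesgue ((\<lambda>v. x0 + r *\<^sub>R v) ` E) = r ^ ?n * measure lebesgue E"
      using measure_lebesgue_affine[of r x0 E] that by (simp add: add.commute)
    show "(\<lambda>v. x0 + r *\<^sub>R v) ` E \<in> lmeasurable"
      using Ecomp by (intro lmeasurable_compact compact_affinity)
  qed
  \<comment> \<open>For small \<open>\<epsilon>\<close>, the set \<open>B \<epsilon>\<close> lies between the dilates of \<open>x0 + E\<close> by \<open>\<epsilon> / (1 + b \<eta>)\<close> and
      \<open>\<epsilon> (1 + b \<eta>)\<close>, where \<open>\<eta>\<close> bounds the relative error of the linear approximation.\<close>
  have squeeze: "eventually (\<lambda>\<epsilon>. let q = measure lebesgue (B \<epsilon>) / measure lebesgue (cball x0 \<epsilon>) in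
      ?L / (1 + b * \<eta>) ^ ?n \<le> q \<and> q \<le> ?L * (1 + b * \<eta>) ^ ?n) (at_right 0)" if "\<eta> > 0" for \<eta>
  proof -
    define k where "k = 1 + b * \<eta>"
    have k1: "k \<ge> 1" and k0: "k > 0" using b that by (auto simp: k_def add_pos_nonneg)
    obtain \<delta>1 where \<delta>1: "\<delta>1 > 0"
      "\<And>y. norm (y - x0) < \<delta>1 \<Longrightarrow> norm (f y - f x0 - A (y - x0)) \<le> \<eta> * norm (y - x0)"
      using der[unfolded has_derivative_at_alt, THEN conjunct2, rule_format, OF \<open>\<eta> > 0\<close>] by blast
    obtain \<delta>2 where \<delta>2: "\<delta>2 > 0" "ball x0 \<delta>2 \<subseteq> U" using U open_contains_ball by blast
    have main: "?L / k ^ ?n \<le> measure lebesgue (B \<epsilon>) / measure lebesgue (cball x0 \<epsilon>) \<and>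
        measure lebesgue (B \<epsilon>) / measure lebesgue (cball x0 \<epsilon>) \<le> ?L * k ^ ?n"
      if \<epsilon>: "0 < \<epsilon>" "\<epsilon> < min \<delta>1 \<delta>2" for \<epsilon>
    proof -
      have approx: "\<bar>norm (f y - f x0) - norm (A (y - x0))\<bar> \<le> \<eta> * norm (y - x0)"
        if "norm (y - x0) \<le> \<epsilon>" for y
        using \<delta>1(2)[of y] norm_triangle_ineq3[of "f y - f x0" "A (y - x0)"] that \<epsilon> by linarith
      \<comment> \<open>The linearisation error raises the bound \<epsilon> by at most
        \<open>b * \<eta> * \<epsilon>\<close>, that is, to \<open>\<epsilon> * k\<close>.\<close>
      have upper: "B \<epsilon> \<subseteq> (\<lambda>v. x0 + (\<epsilon> * k) *\<^sub>R v) ` E"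
      proof
        fix x assume "x \<in> B \<epsilon>"
        then have x: "norm (x - x0) \<le> \<epsilon>" "b * norm (f x - f x0) \<le> \<epsilon>" by (auto simp: B_def)
        have "b * norm (A (x - x0)) \<le> b * (norm (f x - f x0) + \<eta> * \<epsilon>)"
        proof (rule mult_left_mono[OF _ b])
          have "\<eta> * norm (x - x0) \<le> \<eta> * \<epsilon>" using x(1) \<open>\<eta> > 0\<close> by simp
          then show "norm (A (x - x0)) \<le> norm (f x - f x0) + \<eta> * \<epsilon>" using approx[OF x(1)] by linarith
        qed
        also have "\<dots> \<le> \<epsilon> * k" using x(2) by (simp add: k_def algebra_simps)
        finally have 1: "b * norm (A (x - x0)) \<le> \<epsilon> * k" .
        have "\<epsilon> \<le> \<epsilon> * k" using k1 \<epsilon> by simp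
        with x(1) have 2: "norm (x - x0) \<le> \<epsilon> * k" by linarith
        let ?v = "(x - x0) /\<^sub>R (\<epsilon> * k)"
        have "\<epsilon> * k > 0" using \<epsilon> k0 by simp
        then have "?v \<in> E" "x = x0 + (\<epsilon> * k) *\<^sub>R ?v"
          using 1 2 k0 \<epsilon> lin unfolding E_def by (auto simp: linear_scale divide_simps abs_mult)
        then show "x \<in> (\<lambda>v. x0 + (\<epsilon> * k) *\<^sub>R v) ` E" by blast
      qed
      \<comment> \<open>Shrinking by \<open>k\<close> leaves exactly the room for the error, as
        \<open>(\<epsilon> / k) * (1 + b * \<eta>) = \<epsilon>\<close>; the radius
        \<open>\<delta>2\<close> keeps the points in \<open>U\<close>.\<close>
      have lower: "(\<lambda>v. x0 + (\<epsilon> / k) *\<^sub>R v) ` E \<subseteq> B \<epsilon>"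
      proof (intro subsetI, elim imageE)
        fix x v assume x: "x = x0 + (\<epsilon> / k) *\<^sub>R v" and v: "v \<in> E"
        have ek: "\<epsilon> / k > 0" "\<epsilon> / k \<le> \<epsilon>" using \<epsilon> k0 k1 by (auto simp: divide_le_eq)
        have n1: "norm (x - x0) \<le> \<epsilon> / k"
          using v ek(1) \<epsilon>(1) k0 mult_left_mono[of "norm v" 1 "\<epsilon> / k"] unfolding x E_def by simp
        then have n2: "norm (x - x0) \<le> \<epsilon>" using ek by linarith
        then have "x \<in> U" using \<epsilon> \<delta>2(2) by (auto simp: dist_norm norm_minus_commute)
        have "b * norm (A v) \<le> 1" using v by (simp add: E_def)
        then have "(\<epsilon> / k) * (b * norm (A v)) \<le> (\<epsilon> / k) * 1" using ek by (intro mult_left_mono) auto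
        then have bA: "b * norm (A (x - x0)) \<le> \<epsilon> / k"
          unfolding x using lin \<epsilon>(1) k0 by (simp add: linear_scale mult_ac)
        have "b * norm (f x - f x0) \<le> b * (norm (A (x - x0)) + \<eta> * (\<epsilon> / k))"
        proof (rule mult_left_mono[OF _ b])
          have "\<eta> * norm (x - x0) \<le> \<eta> * (\<epsilon> / k)" using n1 \<open>\<eta> > 0\<close> by (intro mult_left_mono) auto
          then show "norm (f x - f x0) \<le> norm (A (x - x0)) + \<eta> * (\<epsilon> / k)" using approx[OF n2] by linarith
        qed
        also have "\<dots> \<le> \<epsilon> / k + b * \<eta> * (\<epsilon> / k)" using bA by (simp add: algebra_simps)
        also have "\<dots> = (\<epsilon> / k) * (1 + b * \<eta>)" by (simp add: algebra_simps)
        also have "\<dots> = (\<epsilon> / k) * k" by (simp add: k_def)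
        also have "\<dots> = \<epsilon>" using k0 by simp
        finally show "x \<in> B \<epsilon>" using n2 \<open>x \<in> U\<close> unfolding B_def by simp
      qed
      have pos: "\<epsilon> * k > 0" "\<epsilon> / k > 0" using \<epsilon> k0 by auto
      have "measure lebesgue (B \<epsilon>) \<le> (\<epsilon> * k) ^ ?n * measure lebesgue E"
        using measure_mono_fmeasurable[OF upper fmeasurableD[OF Bmeas] dil(2)[OF pos(1)]]
        by (simp only: dil(1)[OF pos(1)])
      moreover have "(\<epsilon> / k) ^ ?n * measure lebesgue E \<le> measure lebesgue (B \<epsilon>)"
        using measure_mono_fmeasurable[OF lower fmeasurableD[OF dil(2)[OF pos(2)]] Bmeas]
        by (simp only: dil(1)[OF pos(2)])
      moreover have "measure lebesgue (cball x0 \<epsilon>) = unit_ball_vol (real ?n) * \<epsilon> ^ ?n"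
        using \<epsilon> by (simp add: content_cball)
      moreover have "unit_ball_vol (real ?n) > 0" by simp
      ultimately show ?thesis
        using \<epsilon> k0 by (simp add: power_mult_distrib power_divide divide_simps mult_ac)
    qed
    have "eventually (\<lambda>\<epsilon>. \<epsilon> \<in> {0<..<min \<delta>1 \<delta>2}) (at_right 0)"
      using \<delta>1(1) \<delta>2(1) by (intro eventually_at_right_real) simp
    then show ?thesis
      by eventually_elim (use main in \<open>simp add: Let_def k_def\<close>)
  qed
  \<comment> \<open>Both bounds in \<open>squeeze\<close> tend to \<open>?L\<close> as \<eta> tends
    to 0. For a given threshold, \<eta> is fixed first and \<epsilon> is then taken small.\<close>
  have "((\<lambda>\<eta>. ?L / (1 + b * \<eta>) ^ ?n) \<longlongrightarrow> ?L / (1 + b * 0) ^ ?n) (at_right 0)"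
    by (intro tendsto_intros) auto
  then have lo: "((\<lambda>\<eta>. ?L / (1 + b * \<eta>) ^ ?n) \<longlongrightarrow> ?L) (at_right 0)" by simp
  have "((\<lambda>\<eta>. ?L * (1 + b * \<eta>) ^ ?n) \<longlongrightarrow> ?L * (1 + b * 0) ^ ?n) (at_right 0)"
    by (intro tendsto_intros)
  then have up: "((\<lambda>\<eta>. ?L * (1 + b * \<eta>) ^ ?n) \<longlongrightarrow> ?L) (at_right 0)" by simp
  show ?thesis
  proof (rule order_tendstoI)
    fix a assume "a < ?L"
    then have "eventually (\<lambda>\<eta>. a < ?L / (1 + b * \<eta>) ^ ?n \<and> 0 < \<eta>) (at_right 0)"
      by (intro eventually_conj order_tendstoD(1)[OF lo] eventually_at_right_less)
    then obtain \<eta> where \<eta>: "a < ?L / (1 + b * \<eta>) ^ ?n" "0 < \<eta>"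
      using eventually_happens'[OF trivial_limit_at_right_real] by blast
    show "eventually (\<lambda>\<epsilon>. a < measure lebesgue (B \<epsilon>) / measure lebesgue (cball x0 \<epsilon>)) (at_right 0)"
      using squeeze[OF \<eta>(2)] by eventually_elim (use \<eta>(1) in \<open>simp add: Let_def\<close>)
  next
    fix a assume "?L < a"
    then have "eventually (\<lambda>\<eta>. ?L * (1 + b * \<eta>) ^ ?n < a \<and> 0 < \<eta>) (at_right 0)"
      by (intro eventually_conj order_tendstoD(2)[OF up] eventually_at_right_less)
    then obtain \<eta> where \<eta>: "?L * (1 + b * \<eta>) ^ ?n < a" "0 < \<eta>"
      using eventually_happens'[OF trivial_limit_at_right_real] by blast
    show "eventually (\<lambda>\<epsilon>. measure lebesgue (B \<epsilon>) / measure lebesgue (cball x0 \<epsilon>) < a) (at_right 0)"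
      using squeeze[OF \<eta>(2)] by eventually_elim (use \<eta>(1) in \<open>simp add: Let_def\<close>)
  qed
qed

section \<open>Finite-time metric entropy\<close>

lemma ft_ball_two_times:
  assumes "C2_nds {t0, t0 + T} X \<phi>" "x0 \<in> X t0"
  shows "ft_ball {t0, t0 + T} X \<phi> \<alpha> t0 x0 \<epsilon> = {x \<in> X t0. norm (x - x0) \<le> \<epsilon> \<and>
    exp (- \<alpha> * T) * norm (\<phi> (t0 + T) t0 x - \<phi> (t0 + T) t0 x0) \<le> \<epsilon>}"
proof -
  interpret C2_nds "{t0, t0 + T}" X \<phi> by fact
  have "Sup {u, v} \<le> \<epsilon> \<longleftrightarrow> u \<le> \<epsilon> \<and> v \<le> \<epsilon>" for u v :: real
    by (subst cSup_le_iff) auto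
  then show ?thesis
    using identity[of t0] assms(2) unfolding ft_ball_def by (auto simp: mult.commute)
qed

lemma C2_on_imp_differentiable: "C2_on f S \<Longrightarrow> x \<in> S \<Longrightarrow> f differentiable at x"
  unfolding C2_on_def differentiable_def by blast

lemma C2_on_imp_continuous_on: "C2_on f S \<Longrightarrow> continuous_on S f"
  by (meson C2_on_imp_differentiable continuous_at_imp_continuous_on differentiable_imp_continuous_within)

text \<open>The map \<open>\<phi> s t\<close> undoes \<open>\<phi> t s\<close>, so by the chain rule
  its Jacobian is a left inverse.\<close>

lemma (in C2_nds) jacobian_kernel_trivial:
  assumes J: "s \<in> J" "t \<in> J" and x: "x \<in> X s" and v: "jacobian (\<phi> t s) (at x) *v v = 0"
  shows "v = 0"
proof -
  let ?A = "jacobian (\<phi> t s) (at x)" and ?C = "jacobian (\<phi> s t) (at (\<phi> t s x))"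
  have 1: "(\<phi> t s has_derivative (*v) ?A) (at x)"
    using C2_fibre[of t s] C2_on_imp_differentiable J x jacobian_works by blast
  have 2: "(\<phi> s t has_derivative (*v) ?C) (at (\<phi> t s x))"
    using C2_fibre[of s t] C2_on_imp_differentiable J maps_fibre x jacobian_works by blast
  have "((\<lambda>y. \<phi> s t (\<phi> t s y)) has_derivative (\<lambda>h. ?C *v (?A *v h))) (at x)"
    using has_derivative_compose[OF 1 2] .
  \<comment> \<open>The cocycle law gives the identity map only on \<open>X s\<close>, which
    suffices since \<open>X s\<close> is open.\<close>
  moreover have "((\<lambda>y. \<phi> s t (\<phi> t s y)) has_derivative (\<lambda>h. h)) (at x)"
    by (rule has_derivative_transform_within_open[OF has_derivative_ident open_fibre[OF J(1)] x])
      (use J cocycle identity in auto)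
  ultimately have "(\<lambda>h. ?C *v (?A *v h)) = (\<lambda>h. h)" by (rule has_derivative_unique)
  then have "?C *v (?A *v v) = v" by metis
  then show ?thesis using v by simp
qed

section \<open>Comparison of the entropy with the Lyapunov exponents\<close>

theorem theorem16:
  fixes X :: "real \<Rightarrow> (real ^ 'n) set"
    and \<phi> :: "real \<Rightarrow> real \<Rightarrow> real ^ 'n \<Rightarrow> real ^ 'n"
    and t0 T \<alpha> :: real
    and x0 :: "real ^ 'n"
  assumes "T > 0"
    and "C2_nds {t0, t0 + T} X \<phi>"
    and "x0 \<in> X t0"
  shows "let n = real CARD('n);
             d = ereal (\<Sum>i = 1..CARD('n). max (ftle \<phi> i t0 x0 T - \<alpha>) 0)
                   - ftme {t0, t0 + T} X \<phi> \<alpha> t0 x0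
         in 0 \<le> d \<and> d \<le> ereal ((n * ln 2 + ln (Gamma (n / 2 + 1)) - n / 2 * ln pi) / T)"
proof -
  interpret C2_nds "{t0, t0 + T}" X \<phi> by fact
  note T = \<open>T > 0\<close>
  define A where "A = jacobian (\<phi> (t0 + T) t0) (at x0)"
  define b where "b = exp (- \<alpha> * T)"
  have b: "b > 0" "ln b = - \<alpha> * T" by (auto simp: b_def)
  have "transpose (transpose A ** A) = transpose A ** A" by (simp add: matrix_transpose_mul)
  then obtain P d where P: "orthogonal_matrix P" "transpose P ** (transpose A ** A) ** P = diag_matrix d"
    by (rule symmetric_matrix_diagonalizable)
  \<comment> \<open>Strict positivity makes the logarithms of the singular values genuine.\<close>
  have d: "d i > 0" for i
    using jacobian_kernel_trivial[of t0 "t0 + T" x0] assms(3) A_def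
    by (intro diagonalized_pos[OF P]) auto
  define m where "m = (\<lambda>i. max 1 (b * sqrt (d i)))"
  have m: "m i > 0" for i by (simp add: m_def)
  define E where "E = {v. norm v \<le> 1 \<and> b * norm (A *v v) \<le> 1}"
  let ?\<omega> = "unit_ball_vol (real CARD('n))" and ?\<mu> = "measure lebesgue E"
  have \<omega>: "?\<omega> > 0" by simp
  have vol: "?\<omega> / (\<Prod>i\<in>UNIV. m i) \<le> ?\<mu>" "?\<mu> \<le> 2 ^ CARD('n) / (\<Prod>i\<in>UNIV. m i)"
    using measure_ball_Int_ellipsoid[OF P less_imp_le[OF b(1)] less_imp_le[OF d]]
    unfolding E_def m_def by blast+
  have pm: "(\<Prod>i\<in>UNIV. m i) > 0" by (intro prod_pos) (simp add: m)
  then have \<mu>: "?\<mu> > 0" using vol(1) \<omega> by (meson divide_pos_pos less_le_trans)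
  have "(\<phi> (t0 + T) t0 has_derivative (*v) A) (at x0)"
    unfolding A_def using C2_fibre[of "t0 + T" t0] C2_on_imp_differentiable assms(3) jacobian_works by blast
  moreover have "open (X t0)" "continuous_on (X t0) (\<phi> (t0 + T) t0)"
    using open_fibre C2_on_imp_continuous_on[OF C2_fibre] by auto
  ultimately have "((\<lambda>\<epsilon>. measure lebesgue {x \<in> X t0. norm (x - x0) \<le> \<epsilon> \<and>
      b * norm (\<phi> (t0 + T) t0 x - \<phi> (t0 + T) t0 x0) \<le> \<epsilon>} / measure lebesgue (cball x0 \<epsilon>))
      \<longlongrightarrow> ?\<mu> / unit_ball_vol (real DIM(real ^ 'n))) (at_right 0)"
    unfolding E_def using assms(3) less_imp_le[OF b(1)] by (intro measure_Bowen_ball_tendsto)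
  then have "((\<lambda>\<epsilon>. measure lebesgue (ft_ball {t0, t0 + T} X \<phi> \<alpha> t0 x0 \<epsilon>) / measure lebesgue (cball x0 \<epsilon>))
      \<longlongrightarrow> ?\<mu> / ?\<omega>) (at_right 0)"
    unfolding ft_ball_two_times[OF assms(2,3)] b_def[symmetric] by simp
  \<comment> \<open>The logarithm passes to the limit because \<open>E\<close> has positive
    volume.\<close>
  then have "((\<lambda>\<epsilon>. ereal (- (1 / T) * ln (measure lebesgue (ft_ball {t0, t0 + T} X \<phi> \<alpha> t0 x0 \<epsilon>)
      / measure lebesgue (cball x0 \<epsilon>)))) \<longlongrightarrow> ereal (- (1 / T) * ln (?\<mu> / ?\<omega>))) (at_right 0)"
  proof (intro tendsto_ereal tendsto_mult tendsto_const tendsto_ln)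
    show "?\<mu> / ?\<omega> \<noteq> 0" using divide_pos_pos[OF \<mu> \<omega>] by linarith
  qed
  \<comment> \<open>A limit equals its upper limit, and \<open>Max J - Min J\<close> is
    \<open>T\<close> since \<open>T > 0\<close>.\<close>
  then have ftme: "ftme {t0, t0 + T} X \<phi> \<alpha> t0 x0 = ereal (- (1 / T) * ln (?\<mu> / ?\<omega>))"
    using T unfolding ftme_def by (simp add: lim_imp_Limsup)
  have "(\<Sum>i = 1..CARD('n). max (ftle \<phi> i t0 x0 T - \<alpha>) 0)
      = (\<Sum>i\<in>UNIV. max (1 / T * ln (sqrt (d i)) - \<alpha>) 0)"
    unfolding ftle_def A_def[symmetric]
    using sum_singular_values_diagonalized[OF P, of "\<lambda>s. max (1 / T * ln s - \<alpha>) 0"] .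
  \<comment> \<open>As \<open>ln b = - \<alpha> * T\<close>, the exponent minus \<alpha> is
    \<open>ln (b * sqrt (d i)) / T\<close>; the maximum with 1 in \<open>m i\<close> becomes the
    positive part under \<open>ln\<close>.\<close>
  also have "\<dots> = (\<Sum>i\<in>UNIV. ln (m i) / T)"
  proof (rule sum.cong)
    fix i
    let ?s = "sqrt (d i)"
    have s: "?s > 0" using d by simp
    have "1 / T * ln ?s - \<alpha> = ln (b * ?s) / T"
      using T b s by (simp add: ln_mult field_simps)
    moreover have "ln (m i) = max 0 (ln (b * ?s))"
      using b s by (auto simp: m_def max_def ln_ge_zero_iff ln_le_zero_iff not_le)
    ultimately show "max (1 / T * ln ?s - \<alpha>) 0 = ln (m i) / T"
      using T by (auto simp: max_def field_simps)
  qed simp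
  also have "\<dots> = ln (\<Prod>i\<in>UNIV. m i) / T"
    using less_imp_neq[OF m] by (subst ln_prod) (auto simp: sum_divide_distrib)
  finally have lyap: "(\<Sum>i = 1..CARD('n). max (ftle \<phi> i t0 x0 T - \<alpha>) 0) = ln (\<Prod>i\<in>UNIV. m i) / T" .
  \<comment> \<open>This bound, from the inscribed ellipsoid, yields the left inequality;
    \<open>upper\<close>, from the enclosing box, yields the right one and contributes the term with
    \<open>ln 2\<close>.\<close>
  have lower: "ln ?\<omega> - ln (\<Prod>i\<in>UNIV. m i) \<le> ln ?\<mu>"
    using ln_le_cancel_iff[THEN iffD2, OF divide_pos_pos[OF \<omega> pm] \<mu> vol(1)]
    using \<omega> pm by (simp add: ln_divide_pos)
  have "ln ?\<mu> \<le> ln (2 ^ CARD('n) / (\<Prod>i\<in>UNIV. m i))"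
    by (rule ln_le_cancel_iff[THEN iffD2, OF \<mu> _ vol(2)]) (simp add: pm)
  also have "\<dots> = real CARD('n) * ln 2 - ln (\<Prod>i\<in>UNIV. m i)"
    by (subst ln_divide_pos) (simp_all add: pm ln_realpow)
  finally have upper: "ln ?\<mu> \<le> real CARD('n) * ln 2 - ln (\<Prod>i\<in>UNIV. m i)" .
  \<comment> \<open>The volume of the unit ball is the source of the terms with \<open>Gamma\<close>
    and \<open>pi\<close>.\<close>
  have "Gamma (real CARD('n) / 2 + 1) > 0" by (simp add: Gamma_real_pos)
  then have ln\<omega>: "ln ?\<omega> = real CARD('n) / 2 * ln pi - ln (Gamma (real CARD('n) / 2 + 1))"
    by (simp add: unit_ball_vol_def ln_divide_pos ln_powr)
  have "ln (\<Prod>i\<in>UNIV. m i) / T + 1 / T * ln (?\<mu> / ?\<omega>) = (ln (\<Prod>i\<in>UNIV. m i) + ln ?\<mu> - ln ?\<omega>) / T"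
    using \<mu> \<omega> by (simp add: ln_divide_pos add_divide_distrib diff_divide_distrib)
  moreover have "0 \<le> (ln (\<Prod>i\<in>UNIV. m i) + ln ?\<mu> - ln ?\<omega>) / T"
    using lower T by simp
  moreover have "(ln (\<Prod>i\<in>UNIV. m i) + ln ?\<mu> - ln ?\<omega>) / T
      \<le> (real CARD('n) * ln 2 + ln (Gamma (real CARD('n) / 2 + 1)) - real CARD('n) / 2 * ln pi) / T"
    using upper T unfolding ln\<omega> by (intro divide_right_mono) auto
  ultimately show ?thesis
    unfolding Let_def ftme lyap by simp
qed

end
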